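(* Let $d\ge 3$ and $t\ge 2$ be integers, and let $c>1/\beta_{t,d}$ be a constant. Then there exists $n_0$ such that for all integers $n,k$ with $k\ge t$, $n\ge n_0$ and $n\ge ck$, every $d$-wise $t$-intersecting family $\mathcal{F}\subseteq\binom{[n]}{k}$ satisfies $$|\mathcal{F}|\le\binom{n-t}{k-t},$$ and equality holds only if $\mathcal{F}$ is isomorphic to $\left\{F\in\binom{[n]}{k}: [t]\subseteq F\right\}$.
   Context: Notation: $[n]=\{1,\dots,n\}$ and $\binom{[n]}{k}$ is the set of all $k$-element subsets of $[n]$. A family $\mathcal{F}\subseteq 2^{[n]}$ is $d$-wise $t$-intersecting if $|F_1\cap\cdots\cap F_d|\ge t$ for all $F_1,\dots,F_d\in\mathcal{F}$. Two families of subsets of $[n]$ are isomorphic if one is the image of the other under a permutation of $[n]$. For integers $t\ge 2$ and $d\ge 3$, let $f_{t,d}(x)=(1-x)^{t+d-3}-x^{d-2}$, and let $\beta_{t,d}\in(0,\frac12)$ denote the root of $f_{t,d}$ in this interval, i.e. $(1-\beta_{t,d})^{t+d-3}-\beta_{t,d}^{d-2}=0$. *)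

theory Defs
  imports Complex_Main "HOL-Library.Ramsey" "HOL-Combinatorics.Permutations"
begin

text \<open>The \<open>d\<close> sets need not be distinct. As \<open>card\<close> is \<open>0\<close> on infinite sets, the notion
  is meant for \<open>d \<ge> 1\<close> and families of finite sets.\<close>

definition wise_intersecting :: "nat \<Rightarrow> nat \<Rightarrow> 'a set set \<Rightarrow> bool" where
  "wise_intersecting d t \<F> \<longleftrightarrow>
     (\<forall>F. (\<forall>i\<in>{1..d}. F i \<in> \<F>) \<longrightarrow> t \<le> card (\<Inter>i\<in>{1..d}. F i))"

definition isomorphic_families :: "nat \<Rightarrow> nat set set \<Rightarrow> nat set set \<Rightarrow> bool" where
  "isomorphic_families n \<F> \<G> \<longleftrightarrow> (\<exists>p. p permutes {1..n} \<and> \<G> = (`) p ` \<F>)"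

text \<open>The exponents use truncated subtraction, which is exact for \<open>t \<ge> 2\<close> and \<open>d \<ge> 3\<close>.\<close>

definition f_poly :: "nat \<Rightarrow> nat \<Rightarrow> real \<Rightarrow> real" where
  "f_poly t d x = (1 - x) ^ (t + d - 3) - x ^ (d - 2)"

definition beta :: "nat \<Rightarrow> nat \<Rightarrow> real" where
  "beta t d = (THE x. 0 < x \<and> x < 1/2 \<and> f_poly t d x = 0)"

lemma beta_ex1:
  assumes "t \<ge> 2" and "d \<ge> 3"
  shows "\<exists>!x. 0 < x \<and> x < 1/2 \<and> f_poly t d x = 0"
proof -
  have at0: "f_poly t d 0 > 0"
    using assms by (simp add: f_poly_def zero_power)
  have "(1/2 :: real) ^ (t + d - 3) < (1/2) ^ (d - 2)"
    using assms by (intro power_strict_decreasing) auto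
  then have at_half: "f_poly t d (1/2) < 0"
    by (simp add: f_poly_def)
  have cont: "\<forall>x. 0 \<le> x \<and> x \<le> 1/2 \<longrightarrow> isCont (f_poly t d) x"
    unfolding f_poly_def by (intro allI impI continuous_intros)
  obtain x where x: "0 \<le> x" "x \<le> 1/2" "f_poly t d x = 0"
    using IVT2[of "f_poly t d" "1/2" 0 0] at0 at_half cont by auto
  have "x \<noteq> 0" "x \<noteq> 1/2"
    using x(3) at0 at_half by (metis less_irrefl)+
  with x have ex: "0 < x \<and> x < 1/2 \<and> f_poly t d x = 0"
    by simp
  have decr: "f_poly t d v < f_poly t d u" if "0 < u" "u < v" "v < 1/2" for u v
  proof -
    have "(1 - v) ^ (t + d - 3) < (1 - u) ^ (t + d - 3)"
      using that assms by (intro power_strict_mono) auto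
    moreover have "u ^ (d - 2) \<le> v ^ (d - 2)"
      using that by (intro power_mono) auto
    ultimately show ?thesis
      by (simp add: f_poly_def)
  qed
  have "u = v" if "0 < u \<and> u < 1/2 \<and> f_poly t d u = 0" "0 < v \<and> v < 1/2 \<and> f_poly t d v = 0" for u v
    using decr[of u v] decr[of v u] that by (cases u v rule: linorder_cases) auto
  with ex show ?thesis
    by blast
qed

lemma beta_root:
  assumes "t \<ge> 2" and "d \<ge> 3"
  shows "0 < beta t d" and "beta t d < 1/2" and "f_poly t d (beta t d) = 0"
  using theI'[OF beta_ex1[OF assms]] by (auto simp: beta_def)

end

theory Submission
  imports Defs
begin

text \<open>
  Call a family trivial if some \<open>t\<close>-set lies in all of its members. A trivial family lies in a
  star, which has \<open>(n - t) choose (k - t)\<close> members, and equality forces it to be the whole star.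

  A non-trivial \<open>d\<close>-wise \<open>t\<close>-intersecting family intersects much better in pairs. If the
  intersection of \<open>d - 1\<close> members had only \<open>t\<close> elements, every further member would have to
  contain it, and the family would be trivial; so any \<open>d - 1\<close> members share \<open>t + 1\<close> elements.
  Repeating this, any two members share \<open>s = t + d - 2\<close> elements
  (\<open>nontrivial_pairwise_intersecting\<close>).

  For pairwise \<open>s\<close>-intersecting \<open>k\<close>-uniform families on \<open>n \<ge> 2 * k - s + 1\<close> points there is the
  bound \<open>(n - 1) choose (k - s)\<close> (\<open>card_pairwise_intersecting_le\<close>), which for \<open>s = 1\<close> is the
  Erdos-Ko-Rado theorem. It follows by induction on \<open>n\<close>: after shifting an element \<open>x\<close> away,
  both the members avoiding \<open>x\<close> and the members containing \<open>x\<close>, with \<open>x\<close> removed, are pairwise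
  \<open>s\<close>-intersecting on \<open>n - 1\<close> points, and the two bounds add up by Pascal's rule.

  Write \<open>p = k / n\<close>. Comparing binomial coefficients factor by factor shows that the quotient of
  \<open>(n - 1) choose (k - s)\<close> by \<open>(n - t) choose (k - t)\<close> is at most
  \<open>n ^ (t - 1) * k ^ (d - 2) / (n - k) ^ (t + d - 3) = p ^ (d - 2) / (1 - p) ^ (t + d - 3)\<close>.
  This is less than \<open>1\<close> exactly when \<open>f_poly t d p > 0\<close>, which holds for \<open>p < beta t d\<close>. So
  non-trivial families are strictly smaller than a star, and this for every \<open>n\<close>.
\<close>

section \<open>Pairwise intersecting families\<close>

definition pairwise_intersecting :: "nat \<Rightarrow> 'a set set \<Rightarrow> bool" where
  "pairwise_intersecting s \<F> \<longleftrightarrow> (\<forall>A\<in>\<F>. \<forall>B\<in>\<F>. s \<le> card (A \<inter> B))"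

lemma pairwise_intersectingD:
  "pairwise_intersecting s \<F> \<Longrightarrow> A \<in> \<F> \<Longrightarrow> B \<in> \<F> \<Longrightarrow> s \<le> card (A \<inter> B)"
  by (auto simp: pairwise_intersecting_def)

lemma card_nsets: "finite X \<Longrightarrow> card (nsets X k) = card X choose k"
  using n_subsets[of X k]
  by (metis (no_types, lifting) Collect_cong finite_subset nsets_def)

lemma pairwise_intersecting_small_uniformity:
  assumes "\<F> \<subseteq> nsets X k" "pairwise_intersecting s \<F>" "k \<le> s"
  shows "card \<F> \<le> 1"
proof -
  have "A = B" if "A \<in> \<F>" "B \<in> \<F>" for A B
  proof -
    have AB: "finite A" "finite B" "card A = k" "card B = k"
      using assms(1) that by (auto simp: nsets_def)
    have "k \<le> card (A \<inter> B)"
      using pairwise_intersectingD[OF assms(2) that] assms(3) by simp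
    then have "A \<inter> B = A" "A \<inter> B = B"
      using AB by (simp_all add: card_seteq)
    then show ?thesis by simp
  qed
  then show ?thesis
    by (metis card.infinite card_le_Suc0_iff_eq One_nat_def zero_le)
qed

section \<open>Shifting\<close>

definition shift :: "'a \<Rightarrow> 'a \<Rightarrow> 'a set set \<Rightarrow> 'a set \<Rightarrow> 'a set" where
  "shift x y \<F> A =
     (if x \<in> A \<and> y \<notin> A \<and> insert y (A - {x}) \<notin> \<F> then insert y (A - {x}) else A)"

lemma card_replace:
  assumes "finite A" "x \<in> A" "y \<notin> A"
  shows "card (insert y (A - {x})) = card A"
proof -
  have "0 < card A" using assms by (auto simp: card_gt_0_iff)
  then show ?thesis using assms by simp
qed

lemma inj_on_shift: "inj_on (shift x y \<F>) \<F>"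
proof (rule inj_onI)
  fix A B
  assume AB: "A \<in> \<F>" "B \<in> \<F>" and eq: "shift x y \<F> A = shift x y \<F> B"
  have undo: "C = insert x (insert y (C - {x}) - {y})" if "x \<in> C" "y \<notin> C" for C
    using that by auto
  have "A = B" if "insert y (A - {x}) = insert y (B - {x})" "x \<in> A" "x \<in> B" "y \<notin> A" "y \<notin> B"
    using undo[OF that(2,4)] undo[OF that(3,5)] unfolding that(1) by (rule trans[OF _ sym])
  then show "A = B"
    using eq AB unfolding shift_def by (auto split: if_splits)
qed

lemma shift_nsets:
  assumes "A \<in> nsets X k" "y \<in> X"
  shows "shift x y \<F> A \<in> nsets X k"
proof -
  have "card (insert y (A - {x})) = k" if "x \<in> A" "y \<notin> A"
    using card_replace[of A x y] assms(1) that unfolding nsets_def by blast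
  then show ?thesis
    using assms by (auto simp: shift_def nsets_def)
qed

text \<open>The only delicate pair is a moved set \<open>A\<close> and an unmoved set \<open>B\<close> that contains \<open>x\<close> but
  not \<open>y\<close>. Then \<open>B\<close> stayed because its shifted copy \<open>B'\<close> is already in the family, and
  \<open>A \<inter> B'\<close> is exactly the intersection of the shifted \<open>A\<close> with \<open>B\<close>.\<close>

lemma shift_pairwise_intersecting:
  assumes fin: "\<And>A. A \<in> \<F> \<Longrightarrow> finite A" and int: "pairwise_intersecting s \<F>" and "x \<noteq> y"
  shows "pairwise_intersecting s (shift x y \<F> ` \<F>)"
proof -
  let ?m = "\<lambda>A. insert y (A - {x})"
  let ?moved = "\<lambda>A. x \<in> A \<and> y \<notin> A \<and> ?m A \<notin> \<F>"
  have mixed: "s \<le> card (?m A \<inter> B)"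
    if A: "A \<in> \<F>" "?moved A" and B: "B \<in> \<F>" "\<not> ?moved B" for A B
  proof -
    have AB: "s \<le> card (A \<inter> B)" "finite (A \<inter> B)"
      using int A B fin by (auto simp: pairwise_intersecting_def)
    consider "y \<in> B" "x \<in> B" | "y \<in> B" "x \<notin> B" | "y \<notin> B" "x \<notin> B" | "y \<notin> B" "x \<in> B" "?m B \<in> \<F>"
      using B by blast
    then show ?thesis
    proof cases
      case 1
      then have "?m A \<inter> B = ?m (A \<inter> B)" by auto
      moreover have "card (?m (A \<inter> B)) = card (A \<inter> B)"
        using 1 A AB by (intro card_replace) auto
      ultimately show ?thesis using AB by simp
    next
      case 2
      then have "?m A \<inter> B = insert y (A \<inter> B)" by auto
      then show ?thesis using AB card_insert_le[of "A \<inter> B" y] by simp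
    next
      case 3
      then have "?m A \<inter> B = A \<inter> B" by auto
      then show ?thesis using AB by simp
    next
      case 4
      then have "?m A \<inter> B = A \<inter> ?m B" using A \<open>x \<noteq> y\<close> by auto
      then show ?thesis using pairwise_intersectingD[OF int A(1) 4(3)] by simp
    qed
  qed
  have "s \<le> card (shift x y \<F> A \<inter> shift x y \<F> B)" if AB: "A \<in> \<F>" "B \<in> \<F>" for A B
  proof -
    have sAB: "s \<le> card (A \<inter> B)" using pairwise_intersectingD[OF int AB] .
    consider "?moved A" "?moved B" | "?moved A" "\<not> ?moved B" | "\<not> ?moved A" "?moved B"
      | "\<not> ?moved A" "\<not> ?moved B" by blast
    then show ?thesis
    proof cases
      case 1
      then have "?m A \<inter> ?m B = ?m (A \<inter> B)" by auto
      moreover have "card (?m (A \<inter> B)) = card (A \<inter> B)"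
        using 1 AB fin by (intro card_replace) auto
      ultimately show ?thesis using 1 sAB by (simp add: shift_def)
    next
      case 2
      have "shift x y \<F> A = ?m A" "shift x y \<F> B = B"
        using 2 by (auto simp: shift_def)
      then show ?thesis using mixed[OF AB(1) 2(1) AB(2) 2(2)] by (simp only:)
    next
      case 3
      have "shift x y \<F> B = ?m B" "shift x y \<F> A = A"
        using 3 by (auto simp: shift_def)
      then show ?thesis using mixed[OF AB(2) 3(2) AB(1) 3(1)] by (simp only: Int_commute)
    next
      case 4
      have "shift x y \<F> A = A" "shift x y \<F> B = B"
        using 4 by (auto simp: shift_def)
      then show ?thesis using sAB by (simp only:)
    qed
  qed
  then show ?thesis by (auto simp: pairwise_intersecting_def)
qed

text \<open>Every shift that moves a set lowers the number of members containing \<open>x\<close>, so a family that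
  minimises this number is stable under all shifts away from \<open>x\<close>.\<close>

lemma exists_stable_family:
  assumes "finite X" "\<F> \<subseteq> nsets X k" "pairwise_intersecting s \<F>"
  obtains \<G> where "\<G> \<subseteq> nsets X k" "pairwise_intersecting s \<G>" "card \<G> = card \<F>"
    "\<And>A y. A \<in> \<G> \<Longrightarrow> x \<in> A \<Longrightarrow> y \<in> X - A \<Longrightarrow> insert y (A - {x}) \<in> \<G>"
proof -
  let ?P = "\<lambda>\<G>. \<G> \<subseteq> nsets X k \<and> pairwise_intersecting s \<G> \<and> card \<G> = card \<F>"
  let ?deg = "\<lambda>\<G>. card {A \<in> \<G>. x \<in> A}"
  obtain \<G> where \<G>: "?P \<G>" and least: "\<And>\<H>. ?P \<H> \<Longrightarrow> ?deg \<G> \<le> ?deg \<H>"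
    using ex_has_least_nat[of ?P \<F> ?deg] assms by blast
  have fin: "finite \<G>"
    using \<G> assms(1) by (meson finite_imp_finite_nsets finite_subset)
  have "insert y (A - {x}) \<in> \<G>" if A: "A \<in> \<G>" "x \<in> A" and y: "y \<in> X - A" for A y
  proof (rule ccontr)
    assume moved: "insert y (A - {x}) \<notin> \<G>"
    have "x \<noteq> y" using A y by auto
    let ?\<H> = "shift x y \<G> ` \<G>"
    have "?P ?\<H>"
    proof (intro conjI)
      show "?\<H> \<subseteq> nsets X k"
        using \<G> y by (auto intro!: shift_nsets)
      show "pairwise_intersecting s ?\<H>"
        using \<G> \<open>x \<noteq> y\<close> by (intro shift_pairwise_intersecting) (auto simp: nsets_def)
      show "card ?\<H> = card \<F>"
        using \<G> card_image[OF inj_on_shift] by metis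
    qed
    moreover have "{B \<in> ?\<H>. x \<in> B} \<subset> {B \<in> \<G>. x \<in> B}"
    proof -
      have keep: "B \<in> \<G> \<and> shift x y \<G> B = B" if "B \<in> \<G>" "x \<in> shift x y \<G> B" for B
        using that \<open>x \<noteq> y\<close> by (auto simp: shift_def split: if_splits)
      have "A \<notin> ?\<H>"
      proof
        assume "A \<in> ?\<H>"
        then obtain B where B: "B \<in> \<G>" "A = shift x y \<G> B" by blast
        then have "A = B" using keep[of B] A by simp
        then have "shift x y \<G> A = A" using B by simp
        then show False using A y moved by (auto simp: shift_def split: if_splits)
      qed
      moreover have "{B \<in> ?\<H>. x \<in> B} \<subseteq> {B \<in> \<G>. x \<in> B}"
      proof clarify
        fix B assume "B \<in> \<G>" "x \<in> shift x y \<G> B"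
        then show "shift x y \<G> B \<in> \<G>" using keep[of B] by simp
      qed
      ultimately show ?thesis using A by blast
    qed
    then have "?deg ?\<H> < ?deg \<G>"
      using fin by (intro psubset_card_mono) auto
    ultimately show False using least[of ?\<H>] by simp
  qed
  then show ?thesis using that \<G> by blast
qed

text \<open>Stability makes the members containing \<open>x\<close> overlap in one element more: two such members
  with exactly \<open>s\<close> common elements cover only \<open>2 * k - s < card X\<close> points, and replacing \<open>x\<close> in one
  of them by an uncovered point would leave \<open>s - 1\<close> common elements. This pays for removing \<open>x\<close>.\<close>

lemma split_off_element:
  assumes "finite X" "x \<in> X" "\<F> \<subseteq> nsets X k" "pairwise_intersecting s \<F>"
    and "0 < s" "2 * k < card X + s"
  obtains \<A> \<B> where "\<A> \<subseteq> nsets (X - {x}) k" "pairwise_intersecting s \<A>"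
    "\<B> \<subseteq> nsets (X - {x}) (k - 1)" "pairwise_intersecting s \<B>" "card \<F> = card \<A> + card \<B>"
proof -
  obtain \<G> where \<G>: "\<G> \<subseteq> nsets X k" "pairwise_intersecting s \<G>" "card \<G> = card \<F>"
    and stable: "\<And>A y. A \<in> \<G> \<Longrightarrow> x \<in> A \<Longrightarrow> y \<in> X - A \<Longrightarrow> insert y (A - {x}) \<in> \<G>"
    using exists_stable_family[OF assms(1,3,4)] by metis
  define \<A> where "\<A> = {A \<in> \<G>. x \<notin> A}"
  define \<C> where "\<C> = {A \<in> \<G>. x \<in> A}"
  define \<B> where "\<B> = (\<lambda>A. A - {x}) ` \<C>"
  have "finite \<G>"
    using \<G>(1) assms(1) by (meson finite_imp_finite_nsets finite_subset)
  moreover have "\<G> = \<A> \<union> \<C>" "\<A> \<inter> \<C> = {}"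
    by (auto simp: \<A>_def \<C>_def)
  ultimately have "card \<G> = card \<A> + card \<C>"
    by (metis card_Un_disjoint finite_Un)
  moreover have "inj_on (\<lambda>A. A - {x}) \<C>"
    unfolding \<C>_def by (rule inj_onI) blast
  ultimately have "card \<F> = card \<A> + card \<B>"
    using \<G>(3) by (simp add: \<B>_def card_image)
  moreover have "\<A> \<subseteq> nsets (X - {x}) k"
    using \<G>(1) by (auto simp: \<A>_def nsets_def)
  moreover have "pairwise_intersecting s \<A>"
    using \<G>(2) by (auto simp: \<A>_def pairwise_intersecting_def)
  moreover have "\<B> \<subseteq> nsets (X - {x}) (k - 1)"
    using \<G>(1) by (auto simp: \<B>_def \<C>_def nsets_def)
  moreover have "s \<le> card ((A - {x}) \<inter> (B - {x}))" if "A \<in> \<C>" "B \<in> \<C>" for A B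
  proof -
    have A: "A \<in> \<G>" "x \<in> A" "A \<subseteq> X" "finite A" "card A = k"
      and B: "B \<in> \<G>" "x \<in> B" "B \<subseteq> X" "finite B" "card B = k"
      using that \<G>(1) by (auto simp: \<C>_def nsets_def)
    have "(A - {x}) \<inter> (B - {x}) = A \<inter> B - {x}" by auto
    then have link: "card ((A - {x}) \<inter> (B - {x})) = card (A \<inter> B) - 1"
      using A B by simp
    have "card (A \<inter> B) \<noteq> s"
    proof
      assume eq: "card (A \<inter> B) = s"
      have "card (A \<union> B) + s = 2 * k"
        using card_Un_Int[of A B] A B eq by simp
      then have "card (A \<union> B) < card X" using assms(6) by simp
      then have "\<not> X \<subseteq> A \<union> B"
        using card_mono[of "A \<union> B" X] A B by auto
      then obtain y where y: "y \<in> X" "y \<notin> A" "y \<notin> B" by blast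
      have "insert y (A - {x}) \<in> \<G>" using stable A y by blast
      then have "s \<le> card (insert y (A - {x}) \<inter> B)"
        using pairwise_intersectingD \<G>(2) B(1) by blast
      also have "insert y (A - {x}) \<inter> B = A \<inter> B - {x}" using y by auto
      also have "card \<dots> = s - 1" using A B eq by simp
      finally show False using \<open>0 < s\<close> by simp
    qed
    moreover have "s \<le> card (A \<inter> B)"
      using pairwise_intersectingD \<G>(2) A(1) B(1) by blast
    ultimately show ?thesis using link by simp
  qed
  then have "pairwise_intersecting s \<B>"
    by (auto simp: \<B>_def pairwise_intersecting_def)
  ultimately show ?thesis using that by blast
qed

section \<open>The size of pairwise intersecting families\<close>

lemma inj_on_complement: "\<F> \<subseteq> nsets X k \<Longrightarrow> inj_on (\<lambda>A. X - A) \<F>"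
  by (rule inj_on_inverseI[where g = "\<lambda>A. X - A"]) (auto simp: nsets_def)

text \<open>At most one of two complementary sets is a member, so the family contains at most half of
  all \<open>k\<close>-sets, which is \<open>(2 * k - 1) choose (k - 1)\<close>.\<close>

lemma card_intersecting_le_half:
  assumes "finite X" "card X = 2 * k" "0 < k" "\<F> \<subseteq> nsets X k" "pairwise_intersecting 1 \<F>"
  shows "card \<F> \<le> (card X - 1) choose (k - 1)"
proof -
  let ?\<C> = "(\<lambda>A. X - A) ` \<F>"
  have inj: "inj_on (\<lambda>A. X - A) \<F>"
    using assms(4) by (rule inj_on_complement)
  have finF: "finite \<F>"
    using assms(1,4) by (meson finite_imp_finite_nsets finite_subset)
  have "\<F> \<inter> ?\<C> = {}"
  proof -
    have "X - A \<notin> \<F>" if "A \<in> \<F>" for A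
      using pairwise_intersectingD[OF assms(5) that, of "X - A"] by auto
    then show ?thesis by auto
  qed
  then have "2 * card \<F> = card (\<F> \<union> ?\<C>)"
    using finF inj by (simp add: card_Un_disjoint card_image)
  also have "\<dots> \<le> card (nsets X k)"
  proof (rule card_mono)
    show "finite (nsets X k)" using assms(1) by (rule finite_imp_finite_nsets)
    show "\<F> \<union> ?\<C> \<subseteq> nsets X k"
      using assms by (auto simp: nsets_def card_Diff_subset)
  qed
  also have "\<dots> = 2 * k choose k" using assms(1,2) by (simp add: card_nsets)
  also have "\<dots> = 2 * ((2 * k - 1) choose (k - 1))"
  proof -
    have "2 * k choose k = ((2 * k - 1) choose (k - 1)) + ((2 * k - 1) choose k)"
      using assms(3) by (intro choose_reduce_nat) auto
    moreover have "(2 * k - 1) choose k = (2 * k - 1) choose (k - 1)"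
    proof -
      have "k \<le> 2 * k - 1" "2 * k - 1 - k = k - 1" using assms(3) by linarith+
      then show ?thesis using binomial_symmetric[of k "2 * k - 1"] by metis
    qed
    ultimately show ?thesis by linarith
  qed
  finally show ?thesis using assms(2) by simp
qed

text \<open>The induction on \<open>card X\<close> common to all \<open>s\<close>, down to the smallest ground set on which
  the bound holds.\<close>

lemma card_pairwise_intersecting_le_induct:
  assumes base: "\<And>(X :: 'a set) k \<F>. finite X \<Longrightarrow> card X + s = 2 * k + 1 \<Longrightarrow> s < k \<Longrightarrow>
      \<F> \<subseteq> nsets X k \<Longrightarrow> pairwise_intersecting s \<F> \<Longrightarrow> card \<F> \<le> (card X - 1) choose (k - s)"
    and "0 < s"
    and "finite (X :: 'a set)" "2 * k + 1 \<le> card X + s" "\<F> \<subseteq> nsets X k" "pairwise_intersecting s \<F>"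
  shows "card \<F> \<le> (card X - 1) choose (k - s)"
  using assms(3-)
proof (induction "card X" arbitrary: X k \<F> rule: less_induct)
  case less
  consider "k \<le> s" | "s < k" "card X + s = 2 * k + 1" | "s < k" "2 * k + 1 < card X + s"
    using less.prems by linarith
  then show ?case
  proof cases
    case 1
    then show ?thesis
      using pairwise_intersecting_small_uniformity[OF less.prems(3,4)] by simp
  next
    case 2
    then show ?thesis using less.prems by (intro base)
  next
    case 3
    then have X: "2 < card X" by linarith
    then obtain x where x: "x \<in> X" by (cases "X = {}") auto
    have card': "card (X - {x}) = card X - 1" using x by simp
    obtain \<A> \<B> where \<A>: "\<A> \<subseteq> nsets (X - {x}) k" "pairwise_intersecting s \<A>"
      and \<B>: "\<B> \<subseteq> nsets (X - {x}) (k - 1)" "pairwise_intersecting s \<B>"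
      and split: "card \<F> = card \<A> + card \<B>"
    proof (rule split_off_element[OF less.prems(1) x less.prems(3,4) \<open>0 < s\<close>])
      show "2 * k < card X + s" using 3(2) by linarith
    qed
    have smaller: "card (X - {x}) < card X" "finite (X - {x})"
      using card' X less.prems(1) by auto
    have "2 * k + 1 \<le> card (X - {x}) + s" using 3(2) X unfolding card' by linarith
    from less.hyps[OF smaller this \<A>]
    have "card \<A> \<le> (card X - 1 - 1) choose (k - s)" unfolding card' .
    moreover have "2 * (k - 1) + 1 \<le> card (X - {x}) + s" using 3(2) X unfolding card' by linarith
    from less.hyps[OF smaller this \<B>]
    have "card \<B> \<le> (card X - 1 - 1) choose (k - s - 1)"
      unfolding card' by (simp only: diff_commute)
    moreover have "(card X - 1) choose (k - s)
        = ((card X - 1 - 1) choose (k - s - 1)) + ((card X - 1 - 1) choose (k - s))"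
      using 3 X by (intro choose_reduce_nat) auto
    ultimately show ?thesis using split by linarith
  qed
qed

lemma erdos_ko_rado:
  assumes "finite X" "2 * k \<le> card X" "\<F> \<subseteq> nsets X k" "pairwise_intersecting 1 \<F>"
  shows "card \<F> \<le> (card X - 1) choose (k - 1)"
proof (rule card_pairwise_intersecting_le_induct[where s = 1])
  fix X :: "'a set" and k \<F>
  assume "finite X" "card X + 1 = 2 * k + 1" "1 < k" "\<F> \<subseteq> nsets X k" "pairwise_intersecting 1 \<F>"
  then show "card \<F> \<le> (card X - 1) choose (k - 1)"
    by (intro card_intersecting_le_half) auto
qed (use assms in auto)

text \<open>For \<open>n = 2 * k - s + 1\<close> two members cover at most \<open>2 * k - s < n\<close> points, so their complements
  meet. The complements are \<open>(k - s + 1)\<close>-sets, and the Erdos-Ko-Rado bound for them is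
  \<open>(n - 1) choose (k - s)\<close>.\<close>

lemma card_pairwise_intersecting_le:
  assumes "0 < s" "finite X" "2 * k + 1 \<le> card X + s"
    and "\<F> \<subseteq> nsets X k" "pairwise_intersecting s \<F>"
  shows "card \<F> \<le> (card X - 1) choose (k - s)"
proof (rule card_pairwise_intersecting_le_induct[where s = s])
  fix X :: "'a set" and k \<F>
  assume X: "finite X" "card X + s = 2 * k + 1" "s < k"
    and \<F>: "\<F> \<subseteq> nsets X k" "pairwise_intersecting s \<F>"
  let ?\<C> = "(\<lambda>A. X - A) ` \<F>"
  have "inj_on (\<lambda>A. X - A) \<F>"
    using \<F>(1) by (rule inj_on_complement)
  then have "card \<F> = card ?\<C>" by (simp add: card_image)
  also have "\<dots> \<le> (card X - 1) choose ((k + 1 - s) - 1)"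
  proof (rule erdos_ko_rado)
    show "finite X" by fact
    show "2 * (k + 1 - s) \<le> card X" using X assms(1) by linarith
    show "?\<C> \<subseteq> nsets X (k + 1 - s)"
      using \<F>(1) X by (auto simp: nsets_def card_Diff_subset)
    have "1 \<le> card ((X - A) \<inter> (X - B))" if "A \<in> \<F>" "B \<in> \<F>" for A B
    proof -
      have AB: "A \<subseteq> X" "B \<subseteq> X" "finite A" "finite B" "card A = k" "card B = k"
        using that \<F>(1) by (auto simp: nsets_def)
      have "card (A \<union> B) + card (A \<inter> B) = 2 * k"
        using card_Un_Int[of A B] AB by simp
      then have "card (A \<union> B) < card X"
        using pairwise_intersectingD[OF \<F>(2) that] X by linarith
      moreover have "(X - A) \<inter> (X - B) = X - (A \<union> B)" by auto
      ultimately show ?thesis using AB X(1) by (simp add: card_Diff_subset)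
    qed
    then show "pairwise_intersecting 1 ?\<C>" by (auto simp: pairwise_intersecting_def)
  qed
  also have "(k + 1 - s) - 1 = k - s" using X by simp
  finally show "card \<F> \<le> (card X - 1) choose (k - s)" .
qed (use assms in auto)

section \<open>Non-trivial families\<close>

lemma wise_intersecting_Inter:
  assumes "wise_intersecting d t \<F>" "\<G> \<subseteq> \<F>" "\<G> \<noteq> {}" "finite \<G>" "card \<G> \<le> d"
  shows "t \<le> card (\<Inter>\<G>)"
proof -
  obtain h where h: "bij_betw h {1..card \<G>} \<G>"
    using ex_bij_betw_nat_finite_1[OF assms(4)] by blast
  \<comment> \<open>Repeat one member to list \<open>\<G>\<close> with exactly \<open>d\<close> entries.\<close>
  define F where "F i = (if i \<le> card \<G> then h i else h 1)" for i
  have pos: "0 < card \<G>" using assms(3,4) by (simp add: card_gt_0_iff)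
  have himg: "h ` {1..card \<G>} = \<G>" using h by (simp add: bij_betw_def)
  have "F ` {1..d} = \<G>"
  proof
    show "F ` {1..d} \<subseteq> \<G>"
      using himg pos by (auto simp: F_def)
    show "\<G> \<subseteq> F ` {1..d}"
    proof
      fix A assume "A \<in> \<G>"
      then obtain i where "i \<in> {1..card \<G>}" "A = h i" using himg by blast
      then have "A = F i" "i \<in> {1..d}" using assms(5) by (auto simp: F_def)
      then show "A \<in> F ` {1..d}" by blast
    qed
  qed
  moreover from this have "\<forall>i\<in>{1..d}. F i \<in> \<F>" using assms(2) by blast
  ultimately show ?thesis
    using assms(1) unfolding wise_intersecting_def by metis
qed

text \<open>Each step of the induction trades one member for one more common element: if the common
  part of \<open>\<G>\<close> had the least size that the previous step permits, adding any further member could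
  not shrink it. It would then lie in all members of \<open>\<F>\<close>, which contradicts non-triviality.\<close>

lemma nontrivial_Inter:
  assumes wise: "wise_intersecting d t \<F>" and fin: "\<And>A. A \<in> \<F> \<Longrightarrow> finite A"
    and nontriv: "\<And>T. card T = t \<Longrightarrow> \<exists>A\<in>\<F>. \<not> T \<subseteq> A"
    and "\<G> \<subseteq> \<F>" "\<G> \<noteq> {}" "finite \<G>" "card \<G> + e \<le> d"
  shows "t + e \<le> card (\<Inter>\<G>)"
  using assms(4-)
proof (induction e arbitrary: \<G>)
  case 0
  then show ?case using wise_intersecting_Inter[OF wise] by simp
next
  case (Suc e)
  have finI: "finite (\<Inter>\<G>)"
    using Suc.prems fin by (meson Inter_lower ex_in_conv finite_subset subsetD)
  have ge: "t + e \<le> card (\<Inter>\<G>)" using Suc by simp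
  have "card (\<Inter>\<G>) \<noteq> t + e"
  proof
    assume eq: "card (\<Inter>\<G>) = t + e"
    have "\<Inter>\<G> \<subseteq> A" if "A \<in> \<F>" for A
    proof -
      have "card (insert A \<G>) + e \<le> d"
        using Suc.prems card_insert_le_m1[of "card \<G> + 1" \<G> A] by simp
      then have "t + e \<le> card (\<Inter>(insert A \<G>))"
        using Suc.IH[of "insert A \<G>"] Suc.prems that by simp
      then have "\<Inter>(insert A \<G>) = \<Inter>\<G>"
        using eq finI by (intro card_seteq) auto
      then show ?thesis by auto
    qed
    moreover obtain T where T: "T \<subseteq> \<Inter>\<G>" "card T = t"
      using obtain_subset_with_card_n[of t "\<Inter>\<G>"] eq by auto
    ultimately have "T \<subseteq> A" if "A \<in> \<F>" for A
      using that by (meson subset_trans)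
    then show False using nontriv[OF T(2)] by blast
  qed
  then show ?case using ge by simp
qed

lemma nontrivial_pairwise_intersecting:
  assumes "wise_intersecting d t \<F>" "\<And>A. A \<in> \<F> \<Longrightarrow> finite A"
    and "\<And>T. card T = t \<Longrightarrow> \<exists>A\<in>\<F>. \<not> T \<subseteq> A" and "2 \<le> d"
  shows "pairwise_intersecting (t + (d - 2)) \<F>"
  unfolding pairwise_intersecting_def
proof (intro ballI)
  fix A B assume "A \<in> \<F>" "B \<in> \<F>"
  moreover have "card {A, B} \<le> 2" by (simp add: card_insert_if)
  ultimately have "t + (d - 2) \<le> card (\<Inter>{A, B})"
    using assms by (intro nontrivial_Inter[OF assms(1-3)]) auto
  then show "t + (d - 2) \<le> card (A \<inter> B)" by simp
qed

section \<open>Comparing the two bounds\<close>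

lemma binomial_mult_power_le_upper:
  assumes "m + j \<le> N"
  shows "((N + a) choose j) * m ^ a \<le> (N + a) ^ a * (N choose j)"
proof (induction a)
  case (Suc a)
  have absorb: "(N + Suc a - j) * ((N + Suc a) choose j) = (N + Suc a) * ((N + a) choose j)"
    using binomial_absorb_comp[of "N + Suc a" j] by simp
  have "((N + Suc a) choose j) * m ^ Suc a = (m * ((N + Suc a) choose j)) * m ^ a"
    by simp
  also have "\<dots> \<le> ((N + Suc a - j) * ((N + Suc a) choose j)) * m ^ a"
    using assms by (intro mult_right_mono) auto
  also have "\<dots> = (N + Suc a) * (((N + a) choose j) * m ^ a)"
    unfolding absorb by (simp only: mult_ac)
  also have "\<dots> \<le> (N + Suc a) * ((N + a) ^ a * (N choose j))"
    using Suc by (intro mult_left_mono) auto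
  also have "\<dots> \<le> (N + Suc a) * ((N + Suc a) ^ a * (N choose j))"
    by (intro mult_left_mono mult_right_mono power_mono) auto
  finally show ?case by (simp only: power_Suc mult.assoc)
qed simp

lemma binomial_mult_power_le_lower:
  assumes "m + j + b \<le> N"
  shows "(N choose j) * m ^ b \<le> (j + b) ^ b * (N choose (j + b))"
  using assms
proof (induction b)
  case (Suc b)
  have absorb: "(N - (j + b)) * (N choose (j + b)) = Suc (j + b) * (N choose Suc (j + b))"
    by (metis binomial_absorb_comp binomial_absorption)
  have "(N choose j) * m ^ Suc b = m * ((N choose j) * m ^ b)" by simp
  also have "\<dots> \<le> m * ((j + b) ^ b * (N choose (j + b)))"
    using Suc by (intro mult_left_mono) auto
  also have "\<dots> \<le> (N - (j + b)) * (Suc (j + b) ^ b * (N choose (j + b)))"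
    using Suc.prems by (intro mult_mono power_mono) auto
  also have "\<dots> = Suc (j + b) ^ b * ((N - (j + b)) * (N choose (j + b)))" by simp
  also have "\<dots> = Suc (j + b) ^ Suc b * (N choose Suc (j + b))"
    unfolding absorb by (simp only: power_Suc mult_ac)
  finally show ?case by simp
qed simp

text \<open>Both binomial coefficients are compared with \<open>(n - t) choose (k - (t + b))\<close>: lowering the
  upper index from \<open>n - 1\<close> to \<open>n - t\<close> costs at most a factor \<open>n / (n - k)\<close> per step, and raising the
  lower index to \<open>k - t\<close> costs at most a factor \<open>k / (n - k)\<close> per step.\<close>

lemma choose_less_choose:
  assumes "t + b \<le> k" "0 < t" "k \<le> n"
    and small: "n ^ (t - 1) * k ^ b < (n - k) ^ (t - 1 + b)"
  shows "(n - 1) choose (k - (t + b)) < (n - t) choose (k - t)"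
proof -
  let ?j = "k - (t + b)" and ?m = "n - k"
  have j: "?j + b = k - t" and N: "n - t + (t - 1) = n - 1" using assms by auto
  have "((n - 1) choose ?j) * ?m ^ (t - 1) \<le> (n - 1) ^ (t - 1) * ((n - t) choose ?j)"
    using binomial_mult_power_le_upper[of ?m ?j "n - t" "t - 1"] assms(1,3) unfolding N by simp
  also have "\<dots> \<le> n ^ (t - 1) * ((n - t) choose ?j)"
    by (intro mult_right_mono power_mono) auto
  finally have up: "((n - 1) choose ?j) * ?m ^ (t - 1) \<le> n ^ (t - 1) * ((n - t) choose ?j)" .
  have "((n - t) choose ?j) * ?m ^ b \<le> (k - t) ^ b * ((n - t) choose (k - t))"
    using binomial_mult_power_le_lower[of ?m ?j b "n - t"] assms(1,3) unfolding j by simp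
  also have "\<dots> \<le> k ^ b * ((n - t) choose (k - t))"
    by (intro mult_right_mono power_mono) auto
  finally have low: "((n - t) choose ?j) * ?m ^ b \<le> k ^ b * ((n - t) choose (k - t))" .
  have "((n - 1) choose ?j) * ?m ^ (t - 1 + b) = (((n - 1) choose ?j) * ?m ^ (t - 1)) * ?m ^ b"
    by (simp add: power_add)
  also have "\<dots> \<le> n ^ (t - 1) * (((n - t) choose ?j) * ?m ^ b)"
    using mult_right_mono[OF up, of "?m ^ b"] by (simp add: mult.assoc)
  also have "\<dots> \<le> n ^ (t - 1) * (k ^ b * ((n - t) choose (k - t)))"
    using low by (intro mult_left_mono) auto
  also have "\<dots> = (n ^ (t - 1) * k ^ b) * ((n - t) choose (k - t))"
    by simp
  also have "\<dots> < ?m ^ (t - 1 + b) * ((n - t) choose (k - t))"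
    using small assms(1,3) by (intro mult_strict_right_mono) auto
  finally show ?thesis by (simp add: mult.commute)
qed

lemma power_less_below_beta:
  assumes "t \<ge> 2" "d \<ge> 3" "k < beta t d * n" "0 \<le> k" "0 < n"
  shows "n ^ (t - 1) * k ^ (d - 2) < (n - k) ^ (t - 1 + (d - 2))"
proof -
  define p where "p = k / n"
  have p: "0 \<le> p" "p < beta t d" "k = p * n"
    using assms by (auto simp: p_def field_simps)
  have e: "t + d - 3 = t - 1 + (d - 2)" using assms by simp
  have "p ^ (d - 2) < beta t d ^ (d - 2)"
    using p assms by (intro power_strict_mono) auto
  also have "\<dots> = (1 - beta t d) ^ (t - 1 + (d - 2))"
    using beta_root(3)[OF assms(1,2)] by (simp add: f_poly_def e)
  also have "\<dots> < (1 - p) ^ (t - 1 + (d - 2))"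
    using p beta_root[OF assms(1,2)] assms by (intro power_strict_mono) auto
  finally have "n ^ (t - 1 + (d - 2)) * p ^ (d - 2)
      < n ^ (t - 1 + (d - 2)) * (1 - p) ^ (t - 1 + (d - 2))"
    using assms by (intro mult_strict_left_mono) auto
  moreover have "n ^ (t - 1 + (d - 2)) * p ^ (d - 2) = n ^ (t - 1) * k ^ (d - 2)"
    unfolding p(3) by (simp only: power_add power_mult_distrib mult_ac)
  moreover have "n ^ (t - 1 + (d - 2)) * (1 - p) ^ (t - 1 + (d - 2)) = (n - k) ^ (t - 1 + (d - 2))"
  proof -
    have "n * (1 - p) = n - k" unfolding p(3) by (simp add: algebra_simps)
    then show ?thesis by (metis power_mult_distrib)
  qed
  ultimately show ?thesis by simp
qed

section \<open>Stars\<close>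

lemma card_star:
  assumes "finite X" "T \<subseteq> X" "card T \<le> k"
  shows "card {A \<in> nsets X k. T \<subseteq> A} = (card X - card T) choose (k - card T)"
proof -
  have finT: "finite T" using assms finite_subset by blast
  have "bij_betw (\<lambda>A. A - T) {A \<in> nsets X k. T \<subseteq> A} (nsets (X - T) (k - card T))"
  proof (rule bij_betw_byWitness[where f' = "\<lambda>B. B \<union> T"])
    have "card (B \<union> T) = k" if "B \<in> nsets (X - T) (k - card T)" for B
      using that assms finT by (subst card_Un_disjoint) (auto simp: nsets_def)
    then show "(\<lambda>B. B \<union> T) ` nsets (X - T) (k - card T) \<subseteq> {A \<in> nsets X k. T \<subseteq> A}"
      using assms finT by (auto simp: nsets_def)
  qed (use finT in \<open>auto simp: nsets_def card_Diff_subset\<close>)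
  then have "card {A \<in> nsets X k. T \<subseteq> A} = card (nsets (X - T) (k - card T))"
    by (rule bij_betw_same_card)
  then show ?thesis using assms finT by (simp add: card_nsets card_Diff_subset)
qed

lemma exists_permutation_onto:
  assumes "finite X" "S \<subseteq> X" "T \<subseteq> X" "card S = card T"
  obtains p where "p permutes X" "p ` S = T"
proof -
  have fin: "finite S" "finite T" using assms finite_subset by blast+
  obtain f where f: "bij_betw f S T"
    using finite_same_card_bij fin assms(4) by blast
  obtain g where g: "bij_betw g (X - S) (X - T)"
    using finite_same_card_bij[of "X - S" "X - T"] fin assms by (auto simp: card_Diff_subset)
  define p where "p x = (if x \<in> S then f x else if x \<in> X then g x else x)" for x
  have pS: "bij_betw p S T"
    using f by (rule bij_betw_cong[THEN iffD1, rotated]) (simp add: p_def)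
  moreover have "bij_betw p (X - S) (X - T)"
    using g by (rule bij_betw_cong[THEN iffD1, rotated]) (simp add: p_def)
  ultimately have "bij_betw p (S \<union> (X - S)) (T \<union> (X - T))"
    by (rule bij_betw_combine) auto
  then have "bij_betw p X X" using assms(2,3) by (simp add: Un_absorb1)
  then have "p permutes X"
    using assms(2) by (intro bij_imp_permutes) (auto simp: p_def)
  then show ?thesis using that pS by (simp add: bij_betw_def)
qed

lemma isomorphic_star:
  assumes "T \<subseteq> {1..n}" "card T = t" "t \<le> k"
  shows "isomorphic_families n {A \<in> nsets {1..n} k. T \<subseteq> A} {A \<in> nsets {1..n} k. {1..t} \<subseteq> A}"
proof -
  let ?star = "\<lambda>T. {A \<in> nsets {1..n} k. T \<subseteq> A}"
  have t: "t \<le> n" using card_mono[OF _ assms(1)] assms(2) by simp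
  obtain p where p: "p permutes {1..n}" "p ` T = {1..t}"
    using exists_permutation_onto[of "{1..n}" T "{1..t}"] assms t by auto
  have inj: "inj p" using p(1) by (rule permutes_inj)
  have "(`) p ` ?star T \<subseteq> ?star {1..t}"
  proof clarify
    fix A assume A: "A \<in> nsets {1..n} k" "T \<subseteq> A"
    have "p ` A \<subseteq> p ` {1..n}"
      using A(1) by (intro image_mono) (simp add: nsets_def)
    moreover have "{1..t} \<subseteq> p ` A"
      using image_mono[OF A(2), of p] unfolding p(2) .
    moreover have "card (p ` A) = card A"
      using inj by (meson card_image inj_on_subset subset_UNIV)
    ultimately show "p ` A \<in> nsets {1..n} k \<and> {1..t} \<subseteq> p ` A"
      using A permutes_image[OF p(1)] by (auto simp: nsets_def)
  qed
  moreover have "card ((`) p ` ?star T) = card (?star {1..t})"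
  proof -
    have "card ((`) p ` ?star T) = card (?star T)"
      using inj by (intro card_image) (simp add: inj_on_def inj_image_eq_iff)
    also have "\<dots> = card (?star {1..t})"
      using card_star[of "{1..n}" T k] card_star[of "{1..n}" "{1..t}" k] assms t by simp
    finally show ?thesis .
  qed
  moreover have "finite (?star {1..t})"
    by (simp add: finite_imp_finite_nsets)
  ultimately have "(`) p ` ?star T = ?star {1..t}"
    by (intro card_subset_eq) auto
  then show ?thesis using p(1) unfolding isomorphic_families_def by metis
qed

section \<open>Trivial versus non-trivial families\<close>

theorem theorem8:
  fixes d t :: nat and c :: real
  assumes "d \<ge> 3" and "t \<ge> 2" and "c > 1 / beta t d"
  shows "\<exists>n0. \<forall>n k :: nat. k \<ge> t \<and> n \<ge> n0 \<and> real n \<ge> c * real k \<longrightarrow>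
           (\<forall>\<F>. \<F> \<subseteq> nsets {1..n} k \<and> wise_intersecting d t \<F> \<longrightarrow>
              card \<F> \<le> (n - t) choose (k - t) \<and>
              (card \<F> = (n - t) choose (k - t) \<longrightarrow>
                 isomorphic_families n \<F> {F \<in> nsets {1..n} k. {1..t} \<subseteq> F}))"
proof (intro exI[of _ 0] allI impI; elim conjE)
  fix n k :: nat and \<F>
  assume k: "t \<le> k" and n: "c * real k \<le> real n"
    and \<F>: "\<F> \<subseteq> nsets {1..n} k" and wise: "wise_intersecting d t \<F>"
  let ?star = "\<lambda>T. {A \<in> nsets {1..n} k. T \<subseteq> A}"
  note \<beta> = beta_root[OF assms(2,1)]
  have "1 / beta t d * real k < c * real k"
    using assms k by (intro mult_strict_right_mono) auto
  then have "1 / beta t d * real k < real n" using n by linarith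
  then have below: "real k < beta t d * real n"
    using \<beta> by (simp add: field_simps)
  have "beta t d * real n \<le> 1 / 2 * real n"
    using \<beta> by (intro mult_right_mono) auto
  then have kn: "2 * k < n" using below by linarith
  have pos: "0 < (n - t) choose (k - t)" using kn k by simp
  show "card \<F> \<le> (n - t) choose (k - t) \<and>
      (card \<F> = (n - t) choose (k - t) \<longrightarrow> isomorphic_families n \<F> (?star {1..t}))"
  proof (cases "\<F> = {}")
    case True
    then show ?thesis using pos by auto
  next
    case False
    then obtain A0 where A0: "A0 \<in> \<F>" by blast
    have fin: "finite A" if "A \<in> \<F>" for A using that \<F> by (auto simp: nsets_def)
    show ?thesis
    proof (cases "\<exists>T. card T = t \<and> (\<forall>A\<in>\<F>. T \<subseteq> A)")
      case True
      then obtain T where T: "card T = t" "\<forall>A\<in>\<F>. T \<subseteq> A" by blast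
      have "A0 \<subseteq> {1..n}" using A0 \<F> by (auto simp: nsets_def)
      then have TX: "T \<subseteq> {1..n}" using T(2) A0 by blast
      have card_T: "card (?star T) = (n - t) choose (k - t)"
        using card_star[of "{1..n}" T k] TX T(1) k by simp
      have sub: "\<F> \<subseteq> ?star T" using \<F> T(2) by auto
      have fin_star: "finite (?star T)" by (simp add: finite_imp_finite_nsets)
      have "card \<F> \<le> (n - t) choose (k - t)"
        using card_mono[OF fin_star sub] card_T by simp
      moreover have "\<F> = ?star T" if "card \<F> = (n - t) choose (k - t)"
        using card_subset_eq[OF fin_star sub] card_T that by simp
      ultimately show ?thesis using isomorphic_star[OF TX T(1) k] by metis
    next
      case False
      then have int: "pairwise_intersecting (t + (d - 2)) \<F>"
        using assms(1) fin by (intro nontrivial_pairwise_intersecting[OF wise]) auto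
      have "t + (d - 2) \<le> k"
        using pairwise_intersectingD[OF int A0 A0] A0 \<F> by (auto simp: nsets_def)
      moreover have "n ^ (t - 1) * k ^ (d - 2) < (n - k) ^ (t - 1 + (d - 2))"
      proof -
        have "real (n ^ (t - 1) * k ^ (d - 2)) < real ((n - k) ^ (t - 1 + (d - 2)))"
          using power_less_below_beta[OF assms(2,1) below] kn by (simp add: of_nat_diff)
        then show ?thesis by (simp only: of_nat_less_iff)
      qed
      ultimately have "(n - 1) choose (k - (t + (d - 2))) < (n - t) choose (k - t)"
        using assms(2) kn by (intro choose_less_choose) auto
      moreover have "card \<F> \<le> (n - 1) choose (k - (t + (d - 2)))"
        using card_pairwise_intersecting_le[OF _ _ _ \<F> int] assms(2) kn by simp
      ultimately show ?thesis by simp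
    qed
  qed
qed

end
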